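(* Let $C\subset[0,1]$ be the middle third Cantor set, let $C\times C\subset\mathbb{R}^2$ be its Cartesian product with itself, and let $s=\dim_H(C\times C)=\log_3 4$. Then the $s$-dimensional Hausdorff measure of $C\times C$ satisfies $$H^s(C\times C)\le 1.503263.$$
   Context: The middle third Cantor set $C$ is the unique nonempty compact set with $C=f_1(C)\cup f_2(C)$, where $f_1(x)=x/3$ and $f_2(x)=(x+2)/3$. The plane $\mathbb{R}^2$ carries the Euclidean metric and $|U|$ denotes the diameter of a set $U$. Hausdorff measure is taken without any normalizing constant: for $\delta>0$, $H^s_\delta(E)=\inf\sum_{i=1}^\infty |U_i|^s$, the infimum being over all countable covers $E\subset\bigcup_i U_i$ with $0<|U_i|\le\delta$, and $H^s(E)=\lim_{\delta\to0^+}H^s_\delta(E)$. *)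

theory Defs
  imports "HOL-Analysis.Analysis"
begin

definition is_cantor_attractor :: "real set \<Rightarrow> bool" where
  "is_cantor_attractor C \<longleftrightarrow>
     compact C \<and> C \<noteq> {} \<and> C = (\<lambda>x. x / 3) ` C \<union> (\<lambda>x. (x + 2) / 3) ` C"

definition cantor_set :: "real set" where
  "cantor_set = (THE C. is_cantor_attractor C)"

text \<open>A countable cover is a family indexed by a set of naturals, so finite covers are included.
  Boundedness is required explicitly because \<^const>\<open>diameter\<close> is a real-valued supremum, which
  carries no information on unbounded sets.\<close>

definition delta_covers :: "real \<Rightarrow> 'a::metric_space set \<Rightarrow> (nat set \<times> (nat \<Rightarrow> 'a set)) set" where
  "delta_covers \<delta> E = {(I, U). E \<subseteq> (\<Union>i\<in>I. U i) \<and>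
     (\<forall>i\<in>I. bounded (U i) \<and> 0 < diameter (U i) \<and> diameter (U i) \<le> \<delta>)}"

definition hausdorff_premeasure :: "real \<Rightarrow> real \<Rightarrow> 'a::metric_space set \<Rightarrow> ennreal" where
  "hausdorff_premeasure s \<delta> E =
     (INF (I, U)\<in>delta_covers \<delta> E. \<Sum>\<^sub>\<infinity>i\<in>I. ennreal (diameter (U i) powr s))"

definition hausdorff_measure :: "real \<Rightarrow> 'a::metric_space set \<Rightarrow> ennreal" where
  "hausdorff_measure s E = Lim (at_right 0) (\<lambda>\<delta>. hausdorff_premeasure s \<delta> E)"

text \<open>In a Euclidean space of dimension \<open>n\<close> every set has measure zero for each \<open>s > n\<close>, so the
  infimum below is over a nonempty set of reals that is bounded below.\<close>

definition hausdorff_dim :: "'a::euclidean_space set \<Rightarrow> real" where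
  "hausdorff_dim E = Inf {s. 0 \<le> s \<and> hausdorff_measure s E = 0}"

end

theory Submission
  imports Defs
begin

text \<open>Write \<open>E\<close> for \<open>C \<times> C\<close> and \<open>s\<close> for \<open>log 3 4\<close>, the exponent for which a copy of \<open>E\<close> shrunk by \<open>1/3 ^ n\<close> has
  weight \<open>1/4 ^ n\<close>.

  Upper bound. A single well-chosen set \<open>D\<close> can be more efficient than a set that covers all of \<open>E\<close>. If
  \<open>E\<close> is covered by \<open>D\<close> and finitely many copies of \<open>E\<close> with ratios \<open>\<rho>\<^sub>j\<close>, each copy can again be covered
  by a copy of \<open>D\<close> and smaller copies of \<open>E\<close>, and so on. The premeasure \<open>h\<close> of \<open>E\<close> thus satisfies
  \<open>h \<le> |D| powr s + q * h\<close> where \<open>q\<close> is the sum of the \<open>\<rho>\<^sub>j powr s\<close>, that is, \<open>h \<le> |D| powr s / (1 - q)\<close>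
  (\<open>premeasure_le_of_self_cover\<close>). This controls the premeasure only at the scale of \<open>D\<close>, but replacing
  \<open>E\<close> by its four copies of ratio \<open>1/3\<close> transports any bound at scale \<open>\<delta>\<close> to scale \<open>\<delta>/3\<close> at no extra cost,
  so the premeasure at any one scale bounds the measure (\<open>hausdorff_measure_le_premeasure\<close>).

  The set \<open>D\<close> is the smallest disc around the centre of the unit square that contains what is left of \<open>E\<close> when
  one removes, at each of the four corners, the corner copy of ratio \<open>1/27\<close> and one copy of ratio \<open>1/243\<close> on
  each adjacent side. Then \<open>q = 4 * (1/64 + 2/1024) = 9/128\<close>. A farthest remaining point is \<open>(0, 20/243)\<close>, so that \<open>|D|\<^sup>2 = (243\<^sup>2 + 203\<^sup>2) / 243\<^sup>2\<close>,
  that is, \<open>100258 / 59049\<close>. The resulting bound is about \<open>1.50217\<close>; a rational upper bound \<open>24/19\<close> for \<open>s\<close>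
  is close enough to verify \<open>1.503263\<close> by exact arithmetic (\<open>disc_cost\<close>).

  Dimension. For an exponent \<open>t > s\<close> the four copies of ratio \<open>1/3\<close> weigh less than \<open>1\<close> in total, which forces
  measure zero. For \<open>t \<le> s\<close> the measure is positive by comparison with area: the Cantor function in
  both coordinates maps \<open>E\<close> onto the square and maps sets of small diameter \<open>d\<close> into sets of area \<open>O(d powr s)\<close>
  (\<open>hausdorff_measure_cantor_square_pos\<close>).\<close>

section \<open>Hausdorff premeasures under unions and similarities\<close>

lemma premeasure_le_cover:
  fixes U :: "nat \<Rightarrow> 'a::metric_space set"
  assumes "E \<subseteq> (\<Union>i\<in>I. U i)"
    and "\<And>i. i \<in> I \<Longrightarrow> bounded (U i) \<and> 0 < diameter (U i) \<and> diameter (U i) \<le> \<delta>"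
  shows "hausdorff_premeasure s \<delta> E \<le> (\<Sum>\<^sub>\<infinity>i\<in>I. ennreal (diameter (U i) powr s))"
  unfolding hausdorff_premeasure_def
  by (rule INF_lower2[of "(I, U)"]) (use assms in \<open>auto simp: delta_covers_def\<close>)

lemma premeasure_greatest:
  fixes E :: "'a::metric_space set"
  assumes "\<And>(I :: nat set) (U :: nat \<Rightarrow> 'a set). E \<subseteq> (\<Union>i\<in>I. U i) \<Longrightarrow>
      (\<And>i. i \<in> I \<Longrightarrow> bounded (U i) \<and> 0 < diameter (U i) \<and> diameter (U i) \<le> \<delta>) \<Longrightarrow>
      x \<le> (\<Sum>\<^sub>\<infinity>i\<in>I. ennreal (diameter (U i) powr s))"
  shows "x \<le> hausdorff_premeasure s \<delta> E"
  unfolding hausdorff_premeasure_def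
  by (rule INF_greatest) (auto simp: delta_covers_def intro!: assms)

lemma premeasure_approx:
  fixes E :: "'a::metric_space set"
  assumes "hausdorff_premeasure s \<delta> E < x"
  obtains I and U :: "nat \<Rightarrow> 'a set" where "E \<subseteq> (\<Union>i\<in>I. U i)"
    and "\<And>i. i \<in> I \<Longrightarrow> bounded (U i) \<and> 0 < diameter (U i) \<and> diameter (U i) \<le> \<delta>"
    and "(\<Sum>\<^sub>\<infinity>i\<in>I. ennreal (diameter (U i) powr s)) < x"
  using assms unfolding hausdorff_premeasure_def INF_less_iff
  by (auto simp: delta_covers_def)

lemma premeasure_antimono:
  assumes "\<delta> \<le> \<delta>'"
  shows "hausdorff_premeasure s \<delta>' E \<le> hausdorff_premeasure s \<delta> E"
  using assms by (intro premeasure_greatest premeasure_le_cover) force+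

lemma premeasure_mono:
  fixes A B :: "'a::metric_space set"
  assumes "A \<subseteq> B"
  shows "hausdorff_premeasure s \<delta> A \<le> hausdorff_premeasure s \<delta> B"
proof (rule premeasure_greatest)
  fix I and U :: "nat \<Rightarrow> 'a set"
  assume "B \<subseteq> (\<Union>i\<in>I. U i)"
    and U: "\<And>i. i \<in> I \<Longrightarrow> bounded (U i) \<and> 0 < diameter (U i) \<and> diameter (U i) \<le> \<delta>"
  with assms have "A \<subseteq> (\<Union>i\<in>I. U i)" by blast
  then show "hausdorff_premeasure s \<delta> A \<le> (\<Sum>\<^sub>\<infinity>i\<in>I. ennreal (diameter (U i) powr s))"
    using U by (rule premeasure_le_cover)
qed

lemma premeasure_empty [simp]: "hausdorff_premeasure s \<delta> {} = 0"
  using premeasure_le_cover[where E = "{}" and I = "{}"] by simp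

lemma premeasure_single:
  assumes "bounded D" "0 < diameter D" "diameter D \<le> \<delta>"
  shows "hausdorff_premeasure s \<delta> D \<le> ennreal (diameter D powr s)"
  using premeasure_le_cover[where E = D and I = "{0}" and U = "\<lambda>_. D"] assms by simp

lemma premeasure_Un:
  fixes A B :: "'a::metric_space set"
  shows "hausdorff_premeasure s \<delta> (A \<union> B) \<le> hausdorff_premeasure s \<delta> A + hausdorff_premeasure s \<delta> B"
proof (rule ennreal_le_epsilon)
  fix e :: real
  assume fin: "hausdorff_premeasure s \<delta> A + hausdorff_premeasure s \<delta> B < top" and "0 < e"
  have "hausdorff_premeasure s \<delta> A < hausdorff_premeasure s \<delta> A + ennreal (e / 2)"
    using fin \<open>0 < e\<close> by (auto simp: ennreal_zero_less_divide)
  then obtain I and U :: "nat \<Rightarrow> 'a set" where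
    U: "A \<subseteq> (\<Union>i\<in>I. U i)"
      "\<And>i. i \<in> I \<Longrightarrow> bounded (U i) \<and> 0 < diameter (U i) \<and> diameter (U i) \<le> \<delta>"
      "(\<Sum>\<^sub>\<infinity>i\<in>I. ennreal (diameter (U i) powr s)) < hausdorff_premeasure s \<delta> A + ennreal (e / 2)"
    by (rule premeasure_approx) blast
  have "hausdorff_premeasure s \<delta> B < hausdorff_premeasure s \<delta> B + ennreal (e / 2)"
    using fin \<open>0 < e\<close> by (auto simp: ennreal_zero_less_divide)
  then obtain J and V :: "nat \<Rightarrow> 'a set" where
    V: "B \<subseteq> (\<Union>i\<in>J. V i)"
      "\<And>i. i \<in> J \<Longrightarrow> bounded (V i) \<and> 0 < diameter (V i) \<and> diameter (V i) \<le> \<delta>"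
      "(\<Sum>\<^sub>\<infinity>i\<in>J. ennreal (diameter (V i) powr s)) < hausdorff_premeasure s \<delta> B + ennreal (e / 2)"
    by (rule premeasure_approx) blast
  \<comment> \<open>The two index sets are made disjoint by sending one to the even numbers, the other to the odd ones.\<close>
  define W where "W n = (if even n then U (n div 2) else V (n div 2))" for n :: nat
  have W: "W (2 * n) = U n" "W (Suc (2 * n)) = V n" for n by (simp_all add: W_def)
  define K where "K = (\<lambda>n. 2 * n) ` I \<union> (\<lambda>n. Suc (2 * n)) ` J"
  have disj: "(\<lambda>n. 2 * n) ` I \<inter> (\<lambda>n. Suc (2 * n)) ` J = {}"
    by (auto, presburger)
  have "hausdorff_premeasure s \<delta> (A \<union> B) \<le> (\<Sum>\<^sub>\<infinity>i\<in>K. ennreal (diameter (W i) powr s))"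
  proof (rule premeasure_le_cover)
    have "(\<Union>i\<in>K. W i) = (\<Union>i\<in>I. U i) \<union> (\<Union>i\<in>J. V i)"
      unfolding K_def by (simp add: W UN_Un)
    then show "A \<union> B \<subseteq> (\<Union>i\<in>K. W i)"
      using Un_mono[OF U(1) V(1)] by simp
    show "bounded (W i) \<and> 0 < diameter (W i) \<and> diameter (W i) \<le> \<delta>" if "i \<in> K" for i
    proof -
      from that consider n where "n \<in> I" "i = 2 * n" | n where "n \<in> J" "i = Suc (2 * n)"
        unfolding K_def by blast
      then show ?thesis using U(2) V(2) by cases (simp_all add: W)
    qed
  qed
  also have "\<dots> = (\<Sum>\<^sub>\<infinity>i\<in>(\<lambda>n. 2 * n) ` I. ennreal (diameter (W i) powr s))
                + (\<Sum>\<^sub>\<infinity>i\<in>(\<lambda>n. Suc (2 * n)) ` J. ennreal (diameter (W i) powr s))"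
    unfolding K_def by (intro infsum_Un_disjoint nonneg_summable_on_complete disj) auto
  also have "\<dots> = (\<Sum>\<^sub>\<infinity>i\<in>I. ennreal (diameter (U i) powr s)) + (\<Sum>\<^sub>\<infinity>i\<in>J. ennreal (diameter (V i) powr s))"
    by (subst (1 2) infsum_reindex) (simp_all add: inj_on_def o_def W)
  also have "\<dots> \<le> (hausdorff_premeasure s \<delta> A + ennreal (e / 2)) + (hausdorff_premeasure s \<delta> B + ennreal (e / 2))"
    using U(3) V(3) by (intro add_mono) auto
  also have "\<dots> = hausdorff_premeasure s \<delta> A + hausdorff_premeasure s \<delta> B + (ennreal (e / 2) + ennreal (e / 2))"
    by (simp add: ac_simps)
  also have "ennreal (e / 2) + ennreal (e / 2) = ennreal e"
    using \<open>0 < e\<close> by (simp flip: ennreal_plus)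
  finally show "hausdorff_premeasure s \<delta> (A \<union> B)
      \<le> hausdorff_premeasure s \<delta> A + hausdorff_premeasure s \<delta> B + ennreal e" .
qed

lemma premeasure_UN:
  assumes "finite J"
  shows "hausdorff_premeasure s \<delta> (\<Union>j\<in>J. A j) \<le> (\<Sum>j\<in>J. hausdorff_premeasure s \<delta> (A j))"
  using assms
proof (induction J rule: finite_induct)
  case (insert j J)
  have "hausdorff_premeasure s \<delta> (\<Union>j\<in>insert j J. A j)
      \<le> hausdorff_premeasure s \<delta> (A j) + hausdorff_premeasure s \<delta> (\<Union>j\<in>J. A j)"
    using premeasure_Un[of s \<delta> "A j"] by simp
  also have "\<dots> \<le> hausdorff_premeasure s \<delta> (A j) + (\<Sum>j\<in>J. hausdorff_premeasure s \<delta> (A j))"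
    by (intro add_left_mono insert.IH)
  finally show ?case using insert.hyps by simp
qed simp

definition similarity :: "real \<Rightarrow> ('a::metric_space \<Rightarrow> 'b::metric_space) \<Rightarrow> bool" where
  "similarity \<rho> g \<longleftrightarrow> 0 < \<rho> \<and> (\<forall>x y. dist (g x) (g y) = \<rho> * dist x y)"

lemma bounded_similarity_image:
  assumes "similarity \<rho> g" "bounded U"
  shows "bounded (g ` U)"
proof -
  obtain x e where "\<forall>y\<in>U. dist x y \<le> e"
    using assms(2) unfolding bounded_def by blast
  then have "\<forall>y\<in>g ` U. dist (g x) y \<le> \<rho> * e"
    using assms(1) by (auto simp: similarity_def)
  then show ?thesis unfolding bounded_def by blast
qed

lemma diameter_similarity_image:
  assumes g: "similarity \<rho> g" and U: "bounded U"
  shows "diameter (g ` U) = \<rho> * diameter U"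
proof (cases "U = {}")
  case False
  have "0 < \<rho>" and eq: "\<And>x y. dist (g x) (g y) = \<rho> * dist x y"
    using g by (auto simp: similarity_def)
  have bdd: "bdd_above (case_prod dist ` (U \<times> U))" if "bounded U" for U :: "'c::metric_space set"
    using diameter_bounded_bound[OF that] by (auto intro!: bdd_aboveI)
  show ?thesis
  proof (rule antisym)
    show "diameter (g ` U) \<le> \<rho> * diameter U"
      using False \<open>0 < \<rho>\<close> diameter_bounded_bound[OF U]
      by (auto simp: diameter_def[of "g ` U"] eq intro!: cSUP_least mult_left_mono)
    have "dist x y \<le> diameter (g ` U) / \<rho>" if "x \<in> U" "y \<in> U" for x y
      using diameter_bounded_bound[OF bounded_similarity_image[OF g U], of "g x" "g y"] that \<open>0 < \<rho>\<close>
      by (simp add: eq field_simps)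
    then have "diameter U \<le> diameter (g ` U) / \<rho>"
      using False by (auto simp: diameter_def[of U] intro!: cSUP_least)
    then show "\<rho> * diameter U \<le> diameter (g ` U)"
      using \<open>0 < \<rho>\<close> by (simp add: field_simps)
  qed
qed simp

lemma infsum_ennreal_cmult:
  fixes f :: "'i \<Rightarrow> ennreal"
  shows "(\<Sum>\<^sub>\<infinity>i\<in>I. c * f i) = c * (\<Sum>\<^sub>\<infinity>i\<in>I. f i)"
  by (simp only: nonneg_infsum_complete[OF zero_le] SUP_mult_left_ennreal sum_distrib_left)

text \<open>Images of a cover under a similarity form a cover of the image, with every diameter scaled by \<open>\<rho>\<close>.\<close>

lemma premeasure_similarity_image:
  fixes A :: "'a::metric_space set" and g :: "'a \<Rightarrow> 'b::metric_space"
  assumes g: "similarity \<rho> g"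
  shows "hausdorff_premeasure s (\<rho> * \<delta>) (g ` A) \<le> ennreal (\<rho> powr s) * hausdorff_premeasure s \<delta> A"
proof -
  have \<rho>: "0 < \<rho>" using g by (simp add: similarity_def)
  let ?c = "ennreal (\<rho> powr s)"
  have c: "0 < ?c" "?c < top" using \<rho> by auto
  have "hausdorff_premeasure s (\<rho> * \<delta>) (g ` A) / ?c \<le> hausdorff_premeasure s \<delta> A"
  proof (rule premeasure_greatest)
    fix I and U :: "nat \<Rightarrow> 'a set"
    assume cover: "A \<subseteq> (\<Union>i\<in>I. U i)"
      and U: "\<And>i. i \<in> I \<Longrightarrow> bounded (U i) \<and> 0 < diameter (U i) \<and> diameter (U i) \<le> \<delta>"
    have "g ` A \<subseteq> (\<Union>i\<in>I. g ` U i)" using cover by blast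
    then have "hausdorff_premeasure s (\<rho> * \<delta>) (g ` A) \<le> (\<Sum>\<^sub>\<infinity>i\<in>I. ennreal (diameter (g ` U i) powr s))"
      by (rule premeasure_le_cover)
        (use U \<rho> in \<open>auto simp: diameter_similarity_image[OF g] bounded_similarity_image[OF g]\<close>)
    also have "\<dots> = (\<Sum>\<^sub>\<infinity>i\<in>I. ?c * ennreal (diameter (U i) powr s))"
      by (rule infsum_cong)
        (use U \<rho> in \<open>simp add: diameter_similarity_image[OF g] powr_mult less_imp_le ennreal_mult\<close>)
    also have "\<dots> = ?c * (\<Sum>\<^sub>\<infinity>i\<in>I. ennreal (diameter (U i) powr s))"
      by (rule infsum_ennreal_cmult)
    finally show "hausdorff_premeasure s (\<rho> * \<delta>) (g ` A) / ?c \<le> (\<Sum>\<^sub>\<infinity>i\<in>I. ennreal (diameter (U i) powr s))"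
      using c by (intro divide_le_posI_ennreal) (auto simp: mult.commute)
  qed
  then have "?c * (hausdorff_premeasure s (\<rho> * \<delta>) (g ` A) / ?c)
      \<le> ?c * hausdorff_premeasure s \<delta> A"
    by (rule mult_left_mono) simp
  also have "?c * (hausdorff_premeasure s (\<rho> * \<delta>) (g ` A) / ?c) = hausdorff_premeasure s (\<rho> * \<delta>) (g ` A)"
    by (subst ennreal_times_divide, subst mult.commute, rule ennreal_mult_divide_eq) (use c in auto)
  finally show ?thesis .
qed

text \<open>The premeasure grows as \<open>\<delta>\<close> shrinks, so the limit exists and is the supremum.\<close>

lemma hausdorff_measure_eq_SUP:
  "hausdorff_measure s E = (SUP \<delta>\<in>{0<..}. hausdorff_premeasure s \<delta> E)"
  unfolding hausdorff_measure_def
proof (rule tendsto_Lim[OF trivial_limit_at_right_real], rule order_tendstoI)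
  fix a assume "a < (SUP \<delta>\<in>{0<..}. hausdorff_premeasure s \<delta> E)"
  then obtain \<delta> where \<delta>: "0 < \<delta>" "a < hausdorff_premeasure s \<delta> E"
    by (auto simp: less_SUP_iff)
  then have "a < hausdorff_premeasure s \<epsilon> E" if "\<epsilon> < \<delta>" for \<epsilon>
    using premeasure_antimono[of \<epsilon> \<delta> s E] that by auto
  then show "\<forall>\<^sub>F \<delta> in at_right 0. a < hausdorff_premeasure s \<delta> E"
    using \<delta>(1) by (auto simp: eventually_at_right_field)
next
  fix a assume a: "(SUP \<delta>\<in>{0<..}. hausdorff_premeasure s \<delta> E) < a"
  have "hausdorff_premeasure s \<delta> E < a" if "0 < \<delta>" for \<delta>
    using that by (intro le_less_trans[OF SUP_upper a]) simp
  then show "\<forall>\<^sub>F \<delta> in at_right 0. hausdorff_premeasure s \<delta> E < a"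
    by (auto simp: eventually_at_right_field intro: exI[of _ 1])
qed

lemma premeasure_le_measure: "0 < \<delta> \<Longrightarrow> hausdorff_premeasure s \<delta> E \<le> hausdorff_measure s E"
  unfolding hausdorff_measure_eq_SUP by (rule SUP_upper) simp

section \<open>Self-similar covers\<close>

lemma premeasure_UN_similarity_images:
  fixes g :: "'j \<Rightarrow> 'a::metric_space \<Rightarrow> 'a"
  assumes "finite J" and "\<And>j. j \<in> J \<Longrightarrow> similarity (\<rho> j) (g j)"
    and "\<And>j. j \<in> J \<Longrightarrow> \<rho> j * \<delta> \<le> \<epsilon>"
  shows "hausdorff_premeasure s \<epsilon> (\<Union>j\<in>J. g j ` E)
    \<le> ennreal (\<Sum>j\<in>J. \<rho> j powr s) * hausdorff_premeasure s \<delta> E"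
proof -
  have "hausdorff_premeasure s \<epsilon> (\<Union>j\<in>J. g j ` E) \<le> (\<Sum>j\<in>J. hausdorff_premeasure s \<epsilon> (g j ` E))"
    by (rule premeasure_UN) fact
  also have "\<dots> \<le> (\<Sum>j\<in>J. ennreal (\<rho> j powr s) * hausdorff_premeasure s \<delta> E)"
    by (intro sum_mono order_trans[OF premeasure_antimono premeasure_similarity_image] assms)
  also have "\<dots> = ennreal (\<Sum>j\<in>J. \<rho> j powr s) * hausdorff_premeasure s \<delta> E"
    by (simp add: sum_distrib_right flip: sum_ennreal)
  finally show ?thesis .
qed

text \<open>A cover of a shrunken copy of \<open>E\<close>, obtained by rescaling a cover of \<open>E\<close> at scale \<open>\<delta>\<close>, is itself admissible
  at scale \<open>\<delta>\<close>. So the premeasure of \<open>E\<close> occurs on both sides of an inequality with coefficient \<open>q < 1\<close>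
  on the right; being finite, it can be solved for.\<close>

lemma premeasure_le_of_self_cover:
  fixes g :: "'j \<Rightarrow> 'a::metric_space \<Rightarrow> 'a"
  assumes cover: "E \<subseteq> D \<union> (\<Union>j\<in>J. g j ` E)"
    and D: "bounded D" "0 < diameter D" "diameter D \<le> \<delta>"
    and J: "finite J" "\<And>j. j \<in> J \<Longrightarrow> similarity (\<rho> j) (g j)" "\<And>j. j \<in> J \<Longrightarrow> \<rho> j \<le> 1"
    and q: "(\<Sum>j\<in>J. \<rho> j powr s) = q" "q < 1"
    and fin: "hausdorff_premeasure s \<delta> E < top"
  shows "hausdorff_premeasure s \<delta> E \<le> ennreal (diameter D powr s / (1 - q))"
proof -
  have "0 < \<delta>" using D by linarith
  have "0 \<le> q" unfolding q(1)[symmetric] by (intro sum_nonneg) simp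
  obtain h where h: "0 \<le> h" "hausdorff_premeasure s \<delta> E = ennreal h"
    using fin by (cases "hausdorff_premeasure s \<delta> E") auto
  have "hausdorff_premeasure s \<delta> E
      \<le> hausdorff_premeasure s \<delta> D + hausdorff_premeasure s \<delta> (\<Union>j\<in>J. g j ` E)"
    by (rule order_trans[OF premeasure_mono[OF cover] premeasure_Un])
  also have "\<dots> \<le> ennreal (diameter D powr s) + ennreal q * hausdorff_premeasure s \<delta> E"
    unfolding q(1)[symmetric]
    by (intro add_mono premeasure_single premeasure_UN_similarity_images D J)
      (use J(3) \<open>0 < \<delta>\<close> in \<open>auto intro: mult_left_le_one_le simp: mult_le_cancel_right1\<close>)
  finally have "h \<le> diameter D powr s + q * h"
    using h \<open>0 \<le> q\<close> by (simp flip: ennreal_mult ennreal_plus)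
  then have "h \<le> diameter D powr s / (1 - q)"
    using q(2) by (simp add: field_simps)
  then show ?thesis using h by (simp add: ennreal_leI)
qed

text \<open>When the copies weigh at most \<open>1\<close> in total, subdividing a set into its copies does not increase the cost of covers
  but divides their scale; iterating reaches arbitrarily small scales.\<close>

lemma hausdorff_measure_le_premeasure:
  fixes g :: "'j \<Rightarrow> 'a::metric_space \<Rightarrow> 'a"
  assumes E: "E \<subseteq> (\<Union>j\<in>J. g j ` E)"
    and J: "finite J" "\<And>j. j \<in> J \<Longrightarrow> similarity \<rho> (g j)"
    and \<rho>: "0 < \<rho>" "\<rho> < 1" and card: "real (card J) * \<rho> powr s \<le> 1"
    and "0 < \<delta>"
  shows "hausdorff_measure s E \<le> hausdorff_premeasure s \<delta> E"
proof -
  have step: "hausdorff_premeasure s (\<rho> * \<delta>) E \<le> hausdorff_premeasure s \<delta> E" for \<delta>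
  proof -
    have "hausdorff_premeasure s (\<rho> * \<delta>) E
        \<le> ennreal (\<Sum>j\<in>J. \<rho> powr s) * hausdorff_premeasure s \<delta> E"
      by (intro order_trans[OF premeasure_mono[OF E] premeasure_UN_similarity_images] J) auto
    also have "\<dots> \<le> ennreal 1 * hausdorff_premeasure s \<delta> E"
      using card by (intro mult_right_mono ennreal_leI) auto
    finally show ?thesis by simp
  qed
  have iter: "hausdorff_premeasure s (\<rho> ^ n * \<delta>) E \<le> hausdorff_premeasure s \<delta> E" for n
  proof (induction n)
    case (Suc n)
    show ?case using order_trans[OF step[of "\<rho> ^ n * \<delta>"] Suc] by (simp add: mult.assoc)
  qed simp
  show ?thesis unfolding hausdorff_measure_eq_SUP
  proof (rule SUP_least)
    fix \<epsilon> :: real assume "\<epsilon> \<in> {0<..}"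
    then obtain n where "\<rho> ^ n < \<epsilon> / \<delta>"
      using real_arch_pow_inv[of "\<epsilon> / \<delta>" \<rho>] \<rho> \<open>0 < \<delta>\<close> by auto
    then have "\<rho> ^ n * \<delta> \<le> \<epsilon>" using \<open>0 < \<delta>\<close> by (simp add: field_simps)
    then show "hausdorff_premeasure s \<epsilon> E \<le> hausdorff_premeasure s \<delta> E"
      by (rule order_trans[OF premeasure_antimono iter])
  qed
qed

text \<open>When the copies weigh less than \<open>1\<close> in total, the same subdivision shows that the measure is at most \<open>q\<close> times
  itself, and it is finite by the preceding result.\<close>

lemma hausdorff_measure_eq_0:
  fixes g :: "'j \<Rightarrow> 'a::metric_space \<Rightarrow> 'a"
  assumes E: "E \<subseteq> (\<Union>j\<in>J. g j ` E)"
    and J: "finite J" "\<And>j. j \<in> J \<Longrightarrow> similarity \<rho> (g j)"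
    and \<rho>: "0 < \<rho>" "\<rho> < 1" and card: "real (card J) * \<rho> powr s < 1"
    and \<delta>: "0 < \<delta>" "hausdorff_premeasure s \<delta> E < top"
  shows "hausdorff_measure s E = 0"
proof -
  define q where "q = real (card J) * \<rho> powr s"
  have "0 \<le> q" "q < 1" using card by (auto simp: q_def)
  have "hausdorff_measure s E \<le> hausdorff_premeasure s \<delta> E"
    by (rule hausdorff_measure_le_premeasure[OF E J \<rho>]) (use card \<delta> in auto)
  with \<delta>(2) obtain h where h: "0 \<le> h" "hausdorff_measure s E = ennreal h"
    by (cases "hausdorff_measure s E") (auto simp: top_unique)
  have "hausdorff_measure s E \<le> ennreal q * hausdorff_measure s E"
  proof (subst hausdorff_measure_eq_SUP, rule SUP_least)
    fix \<epsilon> :: real assume "\<epsilon> \<in> {0<..}"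
    then have "0 < \<epsilon>" by simp
    have "hausdorff_premeasure s \<epsilon> E
        \<le> ennreal (\<Sum>j\<in>J. \<rho> powr s) * hausdorff_premeasure s (\<epsilon> / \<rho>) E"
      by (intro order_trans[OF premeasure_mono[OF E] premeasure_UN_similarity_images] J) (use \<rho> in auto)
    also have "\<dots> \<le> ennreal q * hausdorff_measure s E"
      unfolding q_def using \<open>0 < \<epsilon>\<close> \<rho> by (simp add: mult_left_mono premeasure_le_measure)
    finally show "hausdorff_premeasure s \<epsilon> E \<le> ennreal q * hausdorff_measure s E" .
  qed
  then have "h \<le> q * h" using h \<open>0 \<le> q\<close> by (simp flip: ennreal_mult)
  then have "h = 0"
    using \<open>q < 1\<close> h(1) mult_strict_right_mono[of q 1 h] by fastforce
  then show ?thesis using h by simp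
qed

section \<open>The Cantor set\<close>

definition cantor_image :: "real set \<Rightarrow> real set" where
  "cantor_image X = (\<lambda>x. x / 3) ` X \<union> (\<lambda>x. (x + 2) / 3) ` X"

lemma cantor_image_mono: "X \<subseteq> Y \<Longrightarrow> cantor_image X \<subseteq> cantor_image Y"
  unfolding cantor_image_def by blast

lemma dist_third:
  fixes x y :: real
  shows "dist (x / 3) (y / 3) = dist x y / 3" and "dist ((x + 2) / 3) ((y + 2) / 3) = dist x y / 3"
  by (simp_all add: dist_real_def abs_if field_simps)

text \<open>The supremum over \<open>A\<close> of the distance to \<open>B\<close> is at most a third of itself, since every point of \<open>A\<close> is a
  contracted point of \<open>A\<close> and the contractions preserve \<open>B\<close>. This one principle yields uniqueness of the attractor and
  is the tool for placing sets inside the Cantor set.\<close>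

lemma subset_of_cantor_image_contraction:
  assumes A: "bounded A" "A \<subseteq> cantor_image A"
    and B: "closed B" "B \<noteq> {}" "cantor_image B \<subseteq> B"
  shows "A \<subseteq> B"
proof (cases "A = {}")
  case False
  obtain b where "b \<in> B" using B(2) by blast
  obtain e where e: "\<And>x. x \<in> A \<Longrightarrow> dist b x \<le> e"
    using A(1) unfolding bounded_any_center[where a = b] by blast
  define M where "M = (SUP x\<in>A. infdist x B)"
  have "infdist x B \<le> e" if "x \<in> A" for x
    using infdist_le2[OF \<open>b \<in> B\<close>] e[OF that] by (simp add: dist_commute)
  then have bdd: "bdd_above ((\<lambda>x. infdist x B) ` A)" by (rule bdd_aboveI2)
  have le_M: "infdist x B \<le> M" if "x \<in> A" for x
    unfolding M_def by (rule cSUP_upper[OF that bdd])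
  have third: "infdist (f x) B \<le> infdist x B / 3"
    if f: "\<And>y. y \<in> B \<Longrightarrow> f y \<in> B" "\<And>y. dist (f x) (f y) = dist x y / 3"
    for f :: "real \<Rightarrow> real" and x
  proof -
    obtain y where "y \<in> B" "infdist x B = dist x y"
      using infdist_attains_inf[OF B(1,2)] by blast
    then show ?thesis using infdist_le[OF f(1)[of y], of "f x"] f(2)[of y] by simp
  qed
  have "infdist x B \<le> M / 3" if "x \<in> A" for x
  proof -
    have "x \<in> cantor_image A" using A(2) that by (rule subsetD)
    then obtain a where "a \<in> A" and "x = a / 3 \<or> x = (a + 2) / 3"
      unfolding cantor_image_def by blast
    moreover have "infdist (a / 3) B \<le> infdist a B / 3"
      by (rule third[of "\<lambda>x. x / 3"]) (use B(3) in \<open>auto simp: cantor_image_def dist_third\<close>)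
    moreover have "infdist ((a + 2) / 3) B \<le> infdist a B / 3"
      by (rule third[of "\<lambda>x. (x + 2) / 3"]) (use B(3) in \<open>auto simp: cantor_image_def dist_third\<close>)
    ultimately have "infdist x B \<le> infdist a B / 3" by metis
    then show ?thesis using le_M[OF \<open>a \<in> A\<close>] by linarith
  qed
  then have "M \<le> M / 3"
    using cSUP_least[OF False, of "\<lambda>x. infdist x B" "M / 3"] by (simp add: M_def)
  then have "infdist x B = 0" if "x \<in> A" for x
    using le_M[OF that] infdist_nonneg[of x B] by linarith
  then show ?thesis
    using in_closed_iff_infdist_zero[OF B(1,2)] by blast
qed simp

lemma is_cantor_attractor_iff:
  "is_cantor_attractor C \<longleftrightarrow> compact C \<and> C \<noteq> {} \<and> cantor_image C = C"
  unfolding is_cantor_attractor_def cantor_image_def by (intro conj_cong refl eq_commute)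

lemma cantor_attractor_unique:
  assumes "is_cantor_attractor C" "is_cantor_attractor C'"
  shows "C = C'"
proof -
  have "C \<subseteq> C'" if "is_cantor_attractor C" "is_cantor_attractor C'" for C C'
  proof (rule subset_of_cantor_image_contraction)
    show "bounded C" "closed C'" "C' \<noteq> {}"
      using that by (simp_all add: is_cantor_attractor_iff compact_imp_bounded compact_imp_closed)
    show "C \<subseteq> cantor_image C" "cantor_image C' \<subseteq> C'"
      using that by (simp_all add: is_cantor_attractor_iff)
  qed
  then show ?thesis using assms by blast
qed

text \<open>The attractor is the largest \<open>X \<subseteq> {0..1}\<close> with \<open>X \<subseteq> cantor_image X\<close>. The closure of such a set has the same property,
  so by maximality the attractor is closed.\<close>

lemma cantor_attractor_exists: "\<exists>C. is_cantor_attractor C"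
proof -
  define F where "F X = {0..1} \<inter> cantor_image X" for X
  define C where "C = gfp F"
  have mono: "mono F"
    by (rule monoI) (use cantor_image_mono in \<open>auto simp: F_def\<close>)
  have C: "C = F C" unfolding C_def by (rule gfp_unfold[OF mono])
  then have unit: "C \<subseteq> {0..1}" unfolding F_def by blast
  have "cantor_image C \<subseteq> {0..1}" using unit by (fastforce simp: cantor_image_def)
  then have eq: "cantor_image C = C" using C unfolding F_def by blast
  have bdd: "bounded C" using bounded_subset[OF _ unit] by simp
  have "closure C \<subseteq> cantor_image (closure C)"
  proof (rule closure_minimal)
    show "C \<subseteq> cantor_image (closure C)"
      using eq cantor_image_mono[OF closure_subset[of C]] by simp
    have "compact ((\<lambda>x. x / 3) ` closure C)" "compact ((\<lambda>x. (x + 2) / 3) ` closure C)"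
      using bdd by (auto intro!: compact_continuous_image continuous_intros)
    then show "closed (cantor_image (closure C))"
      unfolding cantor_image_def by (intro closed_Un compact_imp_closed)
  qed
  moreover have "closure C \<subseteq> {0..1}" using unit by (rule closure_minimal) simp
  ultimately have "closure C \<subseteq> C"
    unfolding C_def by (intro gfp_upperbound) (auto simp: F_def C_def)
  then have "closed C" using closure_subset_eq by blast
  then have "compact C" using bdd by (simp add: compact_eq_bounded_closed)
  moreover have "{0} \<subseteq> C"
    unfolding C_def by (rule gfp_upperbound) (simp add: F_def cantor_image_def)
  ultimately show ?thesis using eq is_cantor_attractor_iff by blast
qed

lemma is_cantor_attractor_cantor_set: "is_cantor_attractor cantor_set"
  unfolding cantor_set_def
  using cantor_attractor_exists cantor_attractor_unique by (metis theI')

lemma cantor_set_fixpoint: "cantor_image cantor_set = cantor_set"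
  and compact_cantor_set: "compact cantor_set"
  and cantor_set_nonempty: "cantor_set \<noteq> {}"
  using is_cantor_attractor_cantor_set unfolding is_cantor_attractor_iff by blast+

lemma subset_cantor_setI: "bounded A \<Longrightarrow> A \<subseteq> cantor_image A \<Longrightarrow> A \<subseteq> cantor_set"
  by (rule subset_of_cantor_image_contraction)
    (simp_all add: cantor_set_fixpoint cantor_set_nonempty compact_imp_closed[OF compact_cantor_set])

lemma cantor_set_subset: "cantor_set \<subseteq> {0..1}"
proof (rule subset_of_cantor_image_contraction)
  show "bounded cantor_set" by (rule compact_imp_bounded[OF compact_cantor_set])
  show "cantor_set \<subseteq> cantor_image cantor_set" by (simp add: cantor_set_fixpoint)
  show "cantor_image {0..1} \<subseteq> {0..1}" by (auto simp: cantor_image_def)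
qed auto

lemma cantor_set_cases:
  assumes "x \<in> cantor_set"
  obtains y where "y \<in> cantor_set" "x = y / 3" | y where "y \<in> cantor_set" "x = (y + 2) / 3"
proof -
  have "x \<in> cantor_image cantor_set" using assms by (simp add: cantor_set_fixpoint)
  then show thesis using that unfolding cantor_image_def by blast
qed

lemma cantor_set_reflect:
  assumes "x \<in> cantor_set"
  shows "1 - x \<in> cantor_set"
proof -
  have "(\<lambda>x. 1 - x) ` cantor_set \<subseteq> cantor_set"
  proof (rule subset_cantor_setI)
    show "bounded ((\<lambda>x. 1 - x) ` cantor_set)"
      by (intro compact_imp_bounded compact_continuous_image continuous_intros compact_cantor_set)
    show "(\<lambda>x. 1 - x) ` cantor_set \<subseteq> cantor_image ((\<lambda>x. 1 - x) ` cantor_set)"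
    proof (rule image_subsetI)
      fix x assume "x \<in> cantor_set"
      then show "1 - x \<in> cantor_image ((\<lambda>x. 1 - x) ` cantor_set)"
      proof (cases rule: cantor_set_cases)
        case (1 y)
        then have "1 - x = ((1 - y) + 2) / 3" by simp
        then show ?thesis using 1 unfolding cantor_image_def by blast
      next
        case (2 y)
        then have "1 - x = (1 - y) / 3" by (simp add: field_simps)
        then show ?thesis using 2 unfolding cantor_image_def by blast
      qed
    qed
  qed
  then show ?thesis using assms by blast
qed

text \<open>Shifting out the first ternary digit, \<open>0\<close> or \<open>2\<close> according to the side of the removed middle third.\<close>

lemma cantor_set_low:
  assumes "x \<in> cantor_set" "x < 2/3"
  shows "3 * x \<in> cantor_set" "x \<le> 1/3"
proof -
  have "3 * x \<in> cantor_set \<and> x \<le> 1/3"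
    using assms(1)
  proof (cases rule: cantor_set_cases)
    case (1 y)
    then have "3 * x = y" by simp
    moreover have "y \<le> 1" using 1 cantor_set_subset by auto
    ultimately show ?thesis using 1(1) by (simp only:) simp
  next
    case (2 y)
    then show ?thesis using cantor_set_subset assms(2) by auto
  qed
  then show "3 * x \<in> cantor_set" "x \<le> 1/3" by auto
qed

lemma cantor_set_high:
  assumes "x \<in> cantor_set" "1/3 < x"
  shows "3 * x - 2 \<in> cantor_set" "2/3 \<le> x"
  using assms cantor_set_low[OF cantor_set_reflect[OF assms(1)]]
    cantor_set_reflect[of "3 * (1 - x)"] by (auto simp: algebra_simps)

section \<open>The square of the Cantor set as a self-similar set\<close>

definition cantor_square :: "(real \<times> real) set" where
  "cantor_square = cantor_set \<times> cantor_set"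

lemma similarity_coordinatewise:
  assumes "0 < \<rho>" "\<bar>a\<bar> = \<rho>" "\<bar>b\<bar> = \<rho>"
  shows "similarity \<rho> (\<lambda>(x, y). (a * x + c, b * y + d))"
proof -
  have "dist (a * x + c) (a * x' + c) = \<rho> * dist x x'" if "\<bar>a\<bar> = \<rho>" for a c x x' :: real
    unfolding that[symmetric] dist_real_def abs_mult[symmetric] by (simp add: right_diff_distrib)
  then have "dist (a * x + c, b * y + d) (a * x' + c, b * y' + d) = \<rho> * dist (x, y) (x', y')" for x y x' y'
    using assms by (simp add: dist_Pair_Pair power_mult_distrib real_sqrt_mult flip: distrib_left)
  then show ?thesis
    using assms(1) by (simp add: similarity_def split_paired_all)
qed

lemma cantor_square_self_similar:
  "cantor_square \<subseteq> (\<Union>j\<in>{0, 2/3} \<times> {0, 2/3}. (\<lambda>(x, y). (1/3 * x + fst j, 1/3 * y + snd j)) ` cantor_square)"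
proof -
  have *: "\<exists>c\<in>{0, 2/3}. \<exists>y\<in>cantor_set. x = 1/3 * y + c" if "x \<in> cantor_set" for x
    using that by (cases rule: cantor_set_cases) (auto simp: add_divide_distrib)
  show ?thesis
  proof
    fix p assume "p \<in> cantor_square"
    then obtain x y where p: "p = (x, y)" "x \<in> cantor_set" "y \<in> cantor_set"
      by (auto simp: cantor_square_def)
    obtain c x' where "c \<in> {0, 2/3}" "x' \<in> cantor_set" "x = 1/3 * x' + c" using *[OF p(2)] by blast
    moreover obtain d y' where "d \<in> {0, 2/3}" "y' \<in> cantor_set" "y = 1/3 * y' + d" using *[OF p(3)] by blast
    ultimately have "p \<in> (\<lambda>(x, y). (1/3 * x + c, 1/3 * y + d)) ` cantor_square"
      and "(c, d) \<in> {0, 2/3} \<times> {0, 2/3}"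
      unfolding p(1) cantor_square_def by (auto intro!: image_eqI[of _ _ "(x', y')"])
    then show "p \<in> (\<Union>j\<in>{0, 2/3} \<times> {0, 2/3}. (\<lambda>(x, y). (1/3 * x + fst j, 1/3 * y + snd j)) ` cantor_square)"
      by (intro UN_I[of "(c, d)"]) simp_all
  qed
qed

lemma premeasure_cantor_square_finite: "hausdorff_premeasure t 2 cantor_square < top"
proof -
  have "cantor_square \<subseteq> cball (1/2 :: real, 1/2 :: real) 1"
  proof
    fix p assume "p \<in> cantor_square"
    then obtain x y where p: "p = (x, y)" "x \<in> {0..1}" "y \<in> {0..1}"
      using cantor_set_subset unfolding cantor_square_def by blast
    then have "\<bar>1/2 - x\<bar> \<le> 1/2" "\<bar>1/2 - y\<bar> \<le> 1/2"
      by (simp_all only: abs_le_iff) auto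
    then have "dist (1/2, 1/2) (x, y) \<le> 1"
      using sqrt_sum_squares_le_sum_abs[of "1/2 - x" "1/2 - y"]
      unfolding dist_Pair_Pair dist_real_def power2_abs by linarith
    then show "p \<in> cball (1/2, 1/2) 1" using p(1) by simp
  qed
  then have "hausdorff_premeasure t 2 cantor_square \<le> hausdorff_premeasure t 2 (cball (1/2 :: real, 1/2 :: real) 1)"
    by (rule premeasure_mono)
  also have "\<dots> \<le> ennreal (2 powr t)"
    using premeasure_single[of "cball (1/2, 1/2) 1 :: (real \<times> real) set" 2 t] by simp
  finally show ?thesis by (simp add: order_le_less_trans)
qed

lemma hausdorff_measure_cantor_square_eq_0:
  assumes "log 3 4 < t"
  shows "hausdorff_measure t cantor_square = 0"
proof (rule hausdorff_measure_eq_0[OF cantor_square_self_similar, where \<rho> = "1/3" and \<delta> = 2])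
  show "similarity (1/3) (\<lambda>(x, y). (1/3 * x + fst j, 1/3 * y + snd j))" for j :: "real \<times> real"
    by (rule similarity_coordinatewise) auto
  have "4 < 3 powr t" using assms by (simp add: log_less_iff)
  then show "real (card ({0, 2/3::real} \<times> {0, 2/3::real})) * (1/3) powr t < 1"
    by (simp add: card_cartesian_product powr_divide field_simps)
  show "hausdorff_premeasure t 2 cantor_square < top" by (rule premeasure_cantor_square_finite)
qed auto

section \<open>A disc that covers all but small corner pieces\<close>

lemma third_pow_powr_log: "(1 / 3 ^ n) powr log 3 4 = 1 / 4 ^ n"
  by (simp add: powr_divide powr_power[symmetric] powr_realpow[symmetric] powr_powr)

text \<open>The radius is the distance from the centre to \<open>(0, 20/243)\<close>: in units of \<open>1/486\<close> the coordinates of the difference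
  are \<open>243\<close> and \<open>203\<close>, and \<open>243\<^sup>2 + 203\<^sup>2 = 100258\<close>.\<close>

definition disc :: "(real \<times> real) set" where
  "disc = cball (1/2, 1/2) (sqrt 100258 / 486)"

text \<open>The bound \<open>log 3 2 \<le> 12/19\<close> amounts to \<open>2 ^ 19 \<le> 3 ^ 12\<close>; \<open>12/19\<close> is a continued fraction convergent of \<open>log 3 2\<close>
  and the coarsest one from above that is accurate enough. What remains is a comparison of rational numbers, after raising to the power \<open>19\<close>.\<close>

lemma disc_cost: "diameter disc powr log 3 4 \<le> 1.503263 * (119 / 128)"
proof -
  define q :: real where "q = 100258 / 59049"
  have q: "0 \<le> q" by (simp add: q_def)
  have diam: "diameter disc = sqrt q"
    by (simp add: disc_def q_def real_sqrt_divide)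
  have "19 * ln 2 = ln (2 ^ 19 :: real)" by (subst ln_realpow) simp_all
  also have "\<dots> \<le> ln (3 ^ 12 :: real)" by simp
  also have "\<dots> = 12 * ln 3" by (subst ln_realpow) simp_all
  finally have "ln 2 / ln 3 \<le> 12 / (19::real)" by (simp add: field_simps)
  moreover have "log 3 4 = 2 * (ln 2 / ln (3::real))"
    using ln_realpow[of 2 2] by (simp add: log_def)
  ultimately have log: "log 3 4 \<le> 24 / 19" by simp
  have "diameter disc powr log 3 4 \<le> diameter disc powr (24 / 19)"
    unfolding diam by (rule powr_mono[OF log]) (simp add: q_def)
  also have "\<dots> = q powr (12 / 19)"
    unfolding diam by (simp only: powr_half_sqrt[OF q, symmetric] powr_powr) simp
  also have "\<dots> \<le> 1.503263 * (119 / 128)"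
  proof (rule power_le_imp_le_base)
    have "(q powr (12 / 19)) ^ Suc 18 = q powr (12 / 19 * real (Suc 18))"
      by (subst powr_powr[symmetric], rule powr_realpow[symmetric]) (simp add: q_def)
    also have "\<dots> = q powr real 12" by simp
    also have "\<dots> = q ^ 12" by (rule powr_realpow) (simp add: q_def)
    also have "\<dots> \<le> (1.503263 * (119 / 128)) ^ Suc 18"
      unfolding q_def by (simp add: divide_simps)
    finally show "(q powr (12 / 19)) ^ Suc 18 \<le> (1.503263 * (119 / 128) :: real) ^ Suc 18" .
  qed simp
  finally show ?thesis .
qed

text \<open>The index \<open>((\<rho>, c, d), a, b)\<close> stands for the map that scales by \<open>\<rho>\<close>, translates by \<open>(c, d)\<close>, and then reflects the
  coordinates selected by \<open>a\<close> and \<open>b\<close> in the centre lines of the unit square. So \<open>corner_pieces\<close>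
  lists the removed copies at the corner \<open>(0, 0)\<close> only.\<close>

definition corner_map :: "(real \<times> real \<times> real) \<times> bool \<times> bool \<Rightarrow> real \<times> real \<Rightarrow> real \<times> real" where
  "corner_map = (\<lambda>((\<rho>, c, d), a, b) (x, y).
     (if a then 1 - (\<rho> * x + c) else \<rho> * x + c, if b then 1 - (\<rho> * y + d) else \<rho> * y + d))"

definition corner_pieces :: "(real \<times> real \<times> real) set" where
  "corner_pieces = {(1/27, 0, 0), (1/243, 0, 2/27), (1/243, 2/27, 0)}"

lemma similarity_corner_map:
  assumes "0 < fst (fst j)"
  shows "similarity (fst (fst j)) (corner_map j)"
proof -
  obtain \<rho> c d a b where j: "j = ((\<rho>, c, d), a, b)" by (metis prod.exhaust)
  have eq: "corner_map j = (\<lambda>(x, y). ((if a then - \<rho> else \<rho>) * x + (if a then 1 - c else c),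
      (if b then - \<rho> else \<rho>) * y + (if b then 1 - d else d)))"
    by (auto simp: corner_map_def j fun_eq_iff)
  show ?thesis
    unfolding eq by (rule similarity_coordinatewise) (use assms in \<open>auto simp: j\<close>)
qed

lemma corner_cost: "(\<Sum>j\<in>corner_pieces \<times> (UNIV :: (bool \<times> bool) set). fst (fst j) powr log 3 4) = 9 / 128"
proof -
  have pow: "(1/27) powr log 3 4 = 1 / 64" "(1/243) powr log 3 4 = 1 / 1024"
    using third_pow_powr_log[of 3] third_pow_powr_log[of 5] by simp_all
  have "(\<Sum>j\<in>corner_pieces \<times> (UNIV :: (bool \<times> bool) set). fst (fst j) powr log 3 4)
      = (\<Sum>p\<in>corner_pieces. \<Sum>r\<in>(UNIV :: (bool \<times> bool) set). fst p powr log 3 4)"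
    by (subst sum.cartesian_product) (simp add: case_prod_beta')
  also have "\<dots> = 9 / 128"
    by (simp add: corner_pieces_def pow)
  finally show ?thesis .
qed

text \<open>At every level, the piece of the Cantor set that contains \<open>0\<close> is isolated from the rest by a gap of its own length.\<close>

lemma cantor_set_near_0:
  assumes "x \<in> cantor_set"
  shows "3 ^ n * x \<in> cantor_set \<and> 3 ^ n * x \<le> 1 \<or> 2 \<le> 3 ^ n * x"
proof (induction n)
  case 0
  show ?case using assms cantor_set_subset by auto
next
  case (Suc n)
  then show ?case
  proof
    assume *: "3 ^ n * x \<in> cantor_set \<and> 3 ^ n * x \<le> 1"
    show ?thesis
    proof (cases "3 ^ n * x < 2/3")
      case True
      then show ?thesis using * cantor_set_low[of "3 ^ n * x"] by (simp add: mult.assoc)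
    qed simp
  qed simp
qed

lemma in_disc:
  assumes "a \<le> u" "u \<le> 1/2" "b \<le> v" "v \<le> 1/2"
    and "(243 - 486 * a)\<^sup>2 + (243 - 486 * b)\<^sup>2 \<le> 100258"
  shows "(u, v) \<in> disc"
proof -
  have "(243 - 486 * u)\<^sup>2 + (243 - 486 * v)\<^sup>2 \<le> (243 - 486 * a)\<^sup>2 + (243 - 486 * b)\<^sup>2"
    using assms(1-4) by (intro add_mono power_mono) auto
  then have "486\<^sup>2 * ((1/2 - u)\<^sup>2 + (1/2 - v)\<^sup>2) \<le> 100258"
    using assms(5) by (simp add: power2_eq_square algebra_simps)
  then have "(1/2 - u)\<^sup>2 + (1/2 - v)\<^sup>2 \<le> (sqrt 100258 / 486)\<^sup>2"
    by (simp add: power_divide)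
  then have "sqrt ((1/2 - u)\<^sup>2 + (1/2 - v)\<^sup>2) \<le> sqrt 100258 / 486"
    by (intro real_le_lsqrt) auto
  then show ?thesis
    unfolding disc_def mem_cball dist_Pair_Pair dist_real_def power2_abs .
qed

text \<open>Near the corner each coordinate lies in the first piece of length \<open>1/27\<close> or is at least \<open>2/27\<close>. If both are small, the point
  is in the corner piece; if both are large, it is well inside the disc. In the mixed case, say \<open>u\<close> small and \<open>v\<close> large, one
  looks at level \<open>1/243\<close>: either each coordinate is within \<open>1/243\<close> of the least value in its range, \<open>0\<close> or \<open>2/27\<close>, or one of them
  exceeds this value by at least \<open>2/243\<close>, and then the point is in the disc.\<close>

lemma corner_cover:
  assumes uv: "u \<in> cantor_set" "v \<in> cantor_set" "u \<le> 1/3" "v \<le> 1/3"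
  shows "(u, v) \<in> disc \<or>
    (\<exists>(\<rho>, c, d)\<in>corner_pieces. \<exists>x\<in>cantor_set. \<exists>y\<in>cantor_set. u = \<rho> * x + c \<and> v = \<rho> * y + d)"
proof -
  have range: "0 \<le> u" "0 \<le> v" using uv cantor_set_subset by auto
  have disc_swap: "(v, u) \<in> disc \<longleftrightarrow> (u, v) \<in> disc" for u v
    by (simp add: disc_def dist_Pair_Pair add.commute)
  have mixed: "(u, v) \<in> disc \<or> (\<exists>x\<in>cantor_set. \<exists>y\<in>cantor_set. u = 1/243 * x \<and> v = 1/243 * y + 2/27)"
    if C: "u \<in> cantor_set" "v \<in> cantor_set" and le: "u \<le> 1/3" "v \<le> 1/3" "2/27 \<le> v" for u v
  proof (rule disjCI)
    assume no: "\<not> (\<exists>x\<in>cantor_set. \<exists>y\<in>cantor_set. u = 1/243 * x \<and> v = 1/243 * y + 2/27)"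
    have "0 \<le> u" using C cantor_set_subset by auto
    show "(u, v) \<in> disc"
    proof (cases "2/243 \<le> u \<or> 20/243 \<le> v")
      case True
      then show ?thesis
        using in_disc[of "2/243" u "2/27" v] in_disc[of 0 u "20/243" v] le \<open>0 \<le> u\<close>
        by (auto simp: power2_eq_square)
    next
      case False
      then have u: "243 * u \<in> cantor_set" using cantor_set_near_0[OF C(1), of 5] by auto
      have "3 * v \<in> cantor_set" using cantor_set_low[OF C(2)] le by auto
      then have "9 * v \<in> cantor_set" using cantor_set_low(1)[of "3 * v"] False by auto
      then have "27 * v - 2 \<in> cantor_set" using cantor_set_high(1)[of "9 * v"] le by auto
      then have "243 * v - 18 \<in> cantor_set" using cantor_set_near_0[of "27 * v - 2" 2] False by auto
      then show ?thesis using no u by (auto simp: field_simps)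
    qed
  qed
  consider "2/27 \<le> u" | "2/27 \<le> v" | "27 * u \<in> cantor_set" "27 * v \<in> cantor_set"
    using cantor_set_near_0[OF uv(1), of 3] cantor_set_near_0[OF uv(2), of 3] by fastforce
  then show ?thesis
  proof cases
    case 1
    then show ?thesis using mixed[of v u] uv by (auto simp: disc_swap corner_pieces_def)
  next
    case 2
    then show ?thesis using mixed[of u v] uv by (auto simp: corner_pieces_def)
  next
    case 3
    then have "\<exists>x\<in>cantor_set. \<exists>y\<in>cantor_set. u = 1/27 * x + 0 \<and> v = 1/27 * y + 0"
      by (intro bexI[of _ "27 * u"] bexI[of _ "27 * v"]) auto
    then show ?thesis unfolding corner_pieces_def by auto
  qed
qed

text \<open>The reflections \<open>x \<mapsto> 1 - x\<close> preserve the Cantor set and the disc, so the claim reduces to the corner at the origin.\<close>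

lemma cantor_square_cover:
  "cantor_square \<subseteq> disc \<union> (\<Union>j\<in>corner_pieces \<times> UNIV. corner_map j ` cantor_square)"
proof
  fix p assume "p \<in> cantor_square"
  then obtain x y where p: "p = (x, y)" "x \<in> cantor_set" "y \<in> cantor_set"
    by (auto simp: cantor_square_def)
  define r where "r z = (if 1/3 < z then 1 - z else z)" for z :: real
  have r: "r z \<in> cantor_set" "r z \<le> 1/3" if "z \<in> cantor_set" for z
    using that cantor_set_reflect[OF that] cantor_set_high(2)[OF that] by (auto simp: r_def)
  have inv: "(if 1/3 < z then 1 - r z else r z) = z" for z by (simp add: r_def)
  have "\<bar>1/2 - r z\<bar> = \<bar>1/2 - z\<bar>" for z by (auto simp: r_def)
  then have disc_r: "(r x, r y) \<in> disc \<longleftrightarrow> (x, y) \<in> disc"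
    by (simp add: disc_def dist_Pair_Pair dist_real_def)
  consider "(x, y) \<in> disc" | \<rho> c d x' y' where "(\<rho>, c, d) \<in> corner_pieces"
    "x' \<in> cantor_set" "y' \<in> cantor_set" "r x = \<rho> * x' + c" "r y = \<rho> * y' + d"
    using corner_cover[of "r x" "r y"] r p disc_r by fast
  then show "p \<in> disc \<union> (\<Union>j\<in>corner_pieces \<times> UNIV. corner_map j ` cantor_square)"
  proof cases
    case 1
    then show ?thesis using p by simp
  next
    case 2
    have "corner_map ((\<rho>, c, d), 1/3 < x, 1/3 < y) (x', y') = p"
      by (simp only: corner_map_def prod.case inv p 2(4,5)[symmetric])
    moreover have "(x', y') \<in> cantor_square" using 2 by (simp add: cantor_square_def)
    ultimately show ?thesis using 2(1) by (intro UnI2 UN_I[of "((\<rho>, c, d), 1/3 < x, 1/3 < y)"]) auto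
  qed
qed

lemma hausdorff_measure_cantor_square_le:
  "hausdorff_measure (log 3 4) cantor_square \<le> ennreal 1.503263"
proof -
  have "hausdorff_measure (log 3 4) cantor_square \<le> hausdorff_premeasure (log 3 4) 2 cantor_square"
  proof (rule hausdorff_measure_le_premeasure[OF cantor_square_self_similar, where \<rho> = "1/3"])
    show "similarity (1/3) (\<lambda>(x, y). (1/3 * x + fst j, 1/3 * y + snd j))" for j :: "real \<times> real"
      by (rule similarity_coordinatewise) auto
    show "real (card ({0, 2/3::real} \<times> {0, 2/3::real})) * (1/3) powr log 3 4 \<le> 1"
      using third_pow_powr_log[of 1] by (simp add: card_cartesian_product)
  qed auto
  also have "\<dots> \<le> ennreal (diameter disc powr log 3 4 / (1 - 9/128))"
  proof (rule premeasure_le_of_self_cover[OF cantor_square_cover])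
    have "sqrt 100258 \<le> 486" by (rule real_le_lsqrt) auto
    then show "bounded disc" "0 < diameter disc" "diameter disc \<le> 2" by (simp_all add: disc_def)
    show "similarity (fst (fst j)) (corner_map j)" "fst (fst j) \<le> 1" if "j \<in> corner_pieces \<times> UNIV" for j
      using that by (auto intro!: similarity_corner_map simp: corner_pieces_def)
    show "finite (corner_pieces \<times> (UNIV :: (bool \<times> bool) set))" by (simp add: corner_pieces_def)
  qed (simp_all add: corner_cost premeasure_cantor_square_finite)
  also have "\<dots> \<le> ennreal 1.503263"
    using disc_cost by (intro ennreal_leI) simp
  finally show ?thesis .
qed

section \<open>Lower bound for the dimension\<close>

definition first_bit :: "real \<Rightarrow> real" where
  "first_bit y = (if y < 1/2 then 0 else 1)"

definition shift :: "real \<Rightarrow> real" where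
  "shift y = 2 * y - first_bit y"

text \<open>The binary digits of \<open>y\<close> reread as ternary digits \<open>0\<close> and \<open>2\<close>: a right inverse of the
  Cantor function. Working with this section instead of the Cantor function itself avoids having to
  single out a ternary expansion of a given point.\<close>

definition binary_to_cantor :: "real \<Rightarrow> real" where
  "binary_to_cantor y = (\<Sum>n. 2 * first_bit ((shift ^^ n) y) * (1/3) ^ Suc n)"

lemma two_thirds_geometric_sums: "(\<lambda>n. 2 * (1/3) ^ Suc n) sums (1::real)"
  using sums_mult[OF geometric_sums[of "1/3 :: real"], of "2/3"] by simp

lemma binary_to_cantor_summable: "summable (\<lambda>n. 2 * first_bit ((shift ^^ n) y) * (1/3) ^ Suc n)"
  by (rule summable_comparison_test'[OF sums_summable[OF two_thirds_geometric_sums], of 0])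
    (simp add: first_bit_def)

lemma binary_to_cantor_bounds: "0 \<le> binary_to_cantor y" "binary_to_cantor y \<le> 1"
proof -
  show "0 \<le> binary_to_cantor y"
    unfolding binary_to_cantor_def by (rule suminf_nonneg[OF binary_to_cantor_summable]) (simp add: first_bit_def)
  have "binary_to_cantor y \<le> (\<Sum>n. 2 * (1/3) ^ Suc n)"
    unfolding binary_to_cantor_def
    by (rule suminf_le[OF _ binary_to_cantor_summable sums_summable[OF two_thirds_geometric_sums]])
      (simp add: first_bit_def)
  then show "binary_to_cantor y \<le> 1" using sums_unique[OF two_thirds_geometric_sums] by simp
qed

lemma binary_to_cantor_rec: "binary_to_cantor y = (binary_to_cantor (shift y) + 2 * first_bit y) / 3"
proof -
  have "binary_to_cantor y
      = (\<Sum>n. (1/3) * (2 * first_bit ((shift ^^ n) (shift y)) * (1/3) ^ Suc n)) + 2 * first_bit y * (1/3)"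
    unfolding binary_to_cantor_def
    using suminf_split_head[OF binary_to_cantor_summable[of y]] 
    by (simp add: funpow_swap1[symmetric] mult_ac)
  also have "(\<Sum>n. (1/3) * (2 * first_bit ((shift ^^ n) (shift y)) * (1/3) ^ Suc n)) = 1/3 * binary_to_cantor (shift y)"
    unfolding binary_to_cantor_def by (rule suminf_mult[OF binary_to_cantor_summable])
  finally show ?thesis by simp
qed

lemma binary_to_cantor_in_cantor_set: "binary_to_cantor y \<in> cantor_set"
proof -
  have "range binary_to_cantor \<subseteq> cantor_set"
  proof (rule subset_cantor_setI)
    show "bounded (range binary_to_cantor)"
      by (rule bounded_subset[of "{0..1}"]) (use binary_to_cantor_bounds in auto)
    have "binary_to_cantor y \<in> cantor_image (range binary_to_cantor)" for y
      unfolding cantor_image_def binary_to_cantor_rec[of y] by (auto simp: first_bit_def)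
    then show "range binary_to_cantor \<subseteq> cantor_image (range binary_to_cantor)" by blast
  qed
  then show ?thesis by blast
qed

text \<open>Points of the Cantor set at distance below \<open>1/3 ^ k\<close> have the same first \<open>k\<close> ternary digits, because
  points whose first digits differ are separated by the middle third. So the preimages share \<open>k\<close> binary
  digits. This is Hoelder continuity of the Cantor function with exponent \<open>log 3 2\<close>.\<close>

lemma binary_to_cantor_expanding:
  assumes "y \<in> {0..<1}" "z \<in> {0..<1}" "\<bar>binary_to_cantor y - binary_to_cantor z\<bar> < 1 / 3 ^ k"
  shows "\<bar>y - z\<bar> \<le> 1 / 2 ^ k"
  using assms
proof (induction k arbitrary: y z)
  case 0
  then show ?case by auto
next
  case (Suc k)
  let ?b = binary_to_cantor
  have shift: "shift x \<in> {0..<1}" if "x \<in> {0..<1}" for x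
    using that by (auto simp: shift_def first_bit_def)
  have "(1::real) / 3 ^ Suc k \<le> 1/3" by simp
  then have lt: "\<bar>?b y - ?b z\<bar> < 1/3" using Suc.prems(3) by linarith
  have eq: "first_bit y = first_bit z"
  proof (rule ccontr)
    assume "first_bit y \<noteq> first_bit z"
    then have "first_bit y = 0 \<and> first_bit z = 1 \<or> first_bit y = 1 \<and> first_bit z = 0"
      by (auto simp: first_bit_def split: if_splits)
    then have "1/3 \<le> ?b z - ?b y \<or> 1/3 \<le> ?b y - ?b z"
      using binary_to_cantor_rec[of y] binary_to_cantor_rec[of z]
        binary_to_cantor_bounds[of "shift y"] binary_to_cantor_bounds[of "shift z"]
      by (elim disjE conjE) simp_all
    then show False using lt by linarith
  qed
  have "?b y - ?b z = (?b (shift y) - ?b (shift z)) / 3"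
    using binary_to_cantor_rec[of y] binary_to_cantor_rec[of z] eq by simp
  then have "\<bar>?b (shift y) - ?b (shift z)\<bar> < 1 / 3 ^ k"
    using Suc.prems(3) by (simp add: abs_divide)
  then have "\<bar>shift y - shift z\<bar> \<le> 1 / 2 ^ k"
    by (intro Suc.IH shift Suc.prems(1,2))
  moreover have "shift y - shift z = 2 * (y - z)" by (simp add: shift_def eq)
  ultimately show ?case by (simp add: abs_mult)
qed

lemma triadic_scale:
  fixes d :: real
  assumes "0 < d" "d < 1"
  obtains k where "1 / 3 ^ Suc k \<le> d" "d < 1 / 3 ^ k"
proof -
  define n where "n = (LEAST n. (1/3) ^ n \<le> d)"
  obtain m where "(1/3) ^ m < d" using real_arch_pow_inv[of d "1/3"] assms by auto
  then have n: "(1/3) ^ n \<le> d"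
    unfolding n_def by (intro LeastI[of "\<lambda>n. (1/3) ^ n \<le> d" m]) simp
  with assms(2) obtain k where k: "n = Suc k" by (cases n) auto
  then have "\<not> (1/3) ^ k \<le> d" unfolding n_def by (intro not_less_Least) simp
  with n k that[of k] show thesis by (simp add: power_one_over power_divide)
qed

lemma emeasure_lborel_Times:
  fixes A B :: "real set"
  assumes "A \<in> sets borel" "B \<in> sets borel"
  shows "emeasure lborel (A \<times> B) = emeasure lborel A * emeasure lborel B"
  using lborel.emeasure_pair_measure_Times[of A lborel B] assms by (simp add: lborel_prod)

text \<open>In the plane the exponent doubles: a set of diameter about \<open>1/3 ^ k\<close> pulls back into a square of side
  \<open>2/2 ^ k\<close>, whose area is comparable to \<open>1/4 ^ k = (1/3 ^ k) powr log 3 4\<close>. The preimage itself need not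
  be measurable, hence the enclosing set \<open>B\<close>. The factor \<open>16\<close> is \<open>2\<^sup>2\<close> for the two-sided interval around a
  point and \<open>4\<close> for rounding the diameter down to a power of \<open>1/3\<close>.\<close>

lemma preimage_in_small_square:
  fixes U :: "(real \<times> real) set"
  assumes U: "bounded U" "0 < diameter U" "diameter U < 1"
  obtains B where "B \<in> sets borel"
    and "\<And>x y. x \<in> {0..<1} \<Longrightarrow> y \<in> {0..<1} \<Longrightarrow> (binary_to_cantor x, binary_to_cantor y) \<in> U \<Longrightarrow> (x, y) \<in> B"
    and "emeasure lborel B \<le> ennreal (16 * diameter U powr log 3 4)"
proof (cases "\<exists>a\<in>{0..<1}. \<exists>b\<in>{0..<1}. (binary_to_cantor a, binary_to_cantor b) \<in> U")
  case True
  then obtain a b where ab: "a \<in> {0..<1}" "b \<in> {0..<1}" "(binary_to_cantor a, binary_to_cantor b) \<in> U"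
    by blast
  obtain k where k: "1 / 3 ^ Suc k \<le> diameter U" "diameter U < 1 / 3 ^ k"
    using triadic_scale[OF U(2,3)] .
  define L :: real where "L = 1 / 2 ^ k"
  define B where "B = {a - L..a + L} \<times> {b - L..b + L}"
  show thesis
  proof
    show "B \<in> sets borel" unfolding B_def by (intro borel_Times) auto
    show "(x, y) \<in> B"
      if xy: "x \<in> {0..<1}" "y \<in> {0..<1}" "(binary_to_cantor x, binary_to_cantor y) \<in> U" for x y
    proof -
      have "dist (binary_to_cantor x, binary_to_cantor y) (binary_to_cantor a, binary_to_cantor b) < 1 / 3 ^ k"
        using diameter_bounded_bound[OF U(1) xy(3) ab(3)] k(2) by linarith
      then have "\<bar>binary_to_cantor x - binary_to_cantor a\<bar> < 1 / 3 ^ k"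
        and "\<bar>binary_to_cantor y - binary_to_cantor b\<bar> < 1 / 3 ^ k"
        using dist_fst_le[of "(binary_to_cantor x, binary_to_cantor y)" "(binary_to_cantor a, binary_to_cantor b)"]
          dist_snd_le[of "(binary_to_cantor x, binary_to_cantor y)" "(binary_to_cantor a, binary_to_cantor b)"]
        by (simp_all add: dist_real_def)
      then have "\<bar>x - a\<bar> \<le> L" "\<bar>y - b\<bar> \<le> L"
        unfolding L_def using xy ab by (auto intro: binary_to_cantor_expanding)
      then show ?thesis unfolding B_def by auto
    qed
    have "0 < L" by (simp add: L_def)
    then have "emeasure lborel B = ennreal ((2 * L) * (2 * L))"
      unfolding B_def by (subst emeasure_lborel_Times) (auto simp flip: ennreal_mult)
    also have "(2 * L) * (2 * L) = 16 * (1 / 3 ^ Suc k) powr log 3 4"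
      unfolding third_pow_powr_log L_def by (simp add: power_mult_distrib[symmetric])
    also have "\<dots> \<le> 16 * diameter U powr log 3 4"
      using k(1) by (intro mult_left_mono powr_mono2) auto
    finally show "emeasure lborel B \<le> ennreal (16 * diameter U powr log 3 4)"
      by (simp add: ennreal_leI)
  qed
next
  case False
  show thesis by (rule that[of "{}"]) (use False in auto)
qed

lemma emeasure_UN_le_infsum:
  fixes B :: "nat \<Rightarrow> 'a set"
  assumes "\<And>i. i \<in> I \<Longrightarrow> B i \<in> sets M"
  shows "emeasure M (\<Union>i\<in>I. B i) \<le> (\<Sum>\<^sub>\<infinity>i\<in>I. emeasure M (B i))"
proof -
  define B' where "B' i = (if i \<in> I then B i else {})" for i
  have "(\<Union>i\<in>I. B i) = (\<Union>i. B' i)" by (auto simp: B'_def)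
  also have "emeasure M \<dots> \<le> (\<Sum>i. emeasure M (B' i))"
    by (rule emeasure_subadditive_countably) (use assms in \<open>auto simp: B'_def\<close>)
  also have "\<dots> \<le> (\<Sum>\<^sub>\<infinity>i\<in>I. emeasure M (B i))"
    unfolding suminf_eq_SUP
  proof (rule SUP_least)
    fix n
    have "(\<Sum>i<n. emeasure M (B' i)) = (\<Sum>i\<in>{..<n} \<inter> I. emeasure M (B i))"
      by (rule sum.mono_neutral_cong_right) (auto simp: B'_def)
    also have "\<dots> \<le> (SUP F\<in>{F. finite F \<and> F \<subseteq> I}. \<Sum>i\<in>F. emeasure M (B i))"
      by (rule SUP_upper) auto
    also have "\<dots> = (\<Sum>\<^sub>\<infinity>i\<in>I. emeasure M (B i))"
      by (rule nonneg_infsum_complete[symmetric]) simp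
    finally show "(\<Sum>i<n. emeasure M (B' i)) \<le> (\<Sum>\<^sub>\<infinity>i\<in>I. emeasure M (B i))" .
  qed
  finally show ?thesis .
qed

text \<open>Mass distribution: every cover of \<open>cantor_square\<close> pulls back to a cover of the half-open unit square,
  which has area \<open>1\<close>, so its cost is at least \<open>1/16\<close>. Diameters below \<open>1\<close> make the cost for an exponent
  \<open>t \<le> log 3 4\<close> at least the one for \<open>log 3 4\<close>.\<close>

lemma hausdorff_measure_cantor_square_pos:
  assumes t: "t \<le> log 3 4"
  shows "hausdorff_measure t cantor_square \<noteq> 0"
proof -
  have "ennreal (1/16) \<le> hausdorff_premeasure t (1/2) cantor_square"
  proof (rule premeasure_greatest)
    fix I and U :: "nat \<Rightarrow> (real \<times> real) set"
    assume cover: "cantor_square \<subseteq> (\<Union>i\<in>I. U i)"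
      and U: "\<And>i. i \<in> I \<Longrightarrow> bounded (U i) \<and> 0 < diameter (U i) \<and> diameter (U i) \<le> 1/2"
    have "\<exists>B. B \<in> sets borel \<and> (\<forall>x\<in>{0..<1}. \<forall>y\<in>{0..<1}. (binary_to_cantor x, binary_to_cantor y) \<in> U i \<longrightarrow> (x, y) \<in> B)
        \<and> emeasure lborel B \<le> ennreal (16 * diameter (U i) powr log 3 4)" if "i \<in> I" for i
    proof -
      have "bounded (U i)" "0 < diameter (U i)" "diameter (U i) < 1" using U[OF that] by auto
      then show ?thesis by (rule preimage_in_small_square) blast
    qed
    then obtain B where B: "\<And>i. i \<in> I \<Longrightarrow> B i \<in> sets borel"
      and B_cover: "\<And>i x y. i \<in> I \<Longrightarrow> x \<in> {0..<1} \<Longrightarrow> y \<in> {0..<1}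
        \<Longrightarrow> (binary_to_cantor x, binary_to_cantor y) \<in> U i \<Longrightarrow> (x, y) \<in> B i"
      and B_small: "\<And>i. i \<in> I \<Longrightarrow> emeasure lborel (B i) \<le> ennreal (16 * diameter (U i) powr log 3 4)"
      by metis
    have "{0..<1} \<times> {0..<1} \<subseteq> (\<Union>i\<in>I. B i)"
    proof clarify
      fix x y :: real assume xy: "x \<in> {0..<1}" "y \<in> {0..<1}"
      have "(binary_to_cantor x, binary_to_cantor y) \<in> cantor_square"
        by (simp add: cantor_square_def binary_to_cantor_in_cantor_set)
      then obtain i where "i \<in> I" "(binary_to_cantor x, binary_to_cantor y) \<in> U i" using cover by blast
      then show "(x, y) \<in> (\<Union>i\<in>I. B i)" using B_cover xy by blast
    qed
    then have "emeasure lborel ({0..<1::real} \<times> {0..<1::real}) \<le> emeasure lborel (\<Union>i\<in>I. B i)"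
      by (rule emeasure_mono) (use B in \<open>auto intro!: sets.countable_UN'\<close>)
    also have "\<dots> \<le> (\<Sum>\<^sub>\<infinity>i\<in>I. emeasure lborel (B i))"
      by (rule emeasure_UN_le_infsum) (use B in simp)
    also have "\<dots> \<le> (\<Sum>\<^sub>\<infinity>i\<in>I. 16 * ennreal (diameter (U i) powr t))"
    proof (rule infsum_mono)
      fix i assume i: "i \<in> I"
      have "16 * diameter (U i) powr log 3 4 \<le> 16 * diameter (U i) powr t"
        using U[OF i] t by (intro mult_left_mono powr_mono') auto
      then have "ennreal (16 * diameter (U i) powr log 3 4) \<le> ennreal (16 * diameter (U i) powr t)"
        by (rule ennreal_leI)
      also have "\<dots> = 16 * ennreal (diameter (U i) powr t)" by (simp add: ennreal_mult)
      finally have "ennreal (16 * diameter (U i) powr log 3 4) \<le> 16 * ennreal (diameter (U i) powr t)" .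
      then show "emeasure lborel (B i) \<le> 16 * ennreal (diameter (U i) powr t)"
        using B_small[OF i] by (rule order_trans[rotated])
    qed (auto intro: nonneg_summable_on_complete)
    also have "\<dots> = 16 * (\<Sum>\<^sub>\<infinity>i\<in>I. ennreal (diameter (U i) powr t))"
      by (rule infsum_ennreal_cmult)
    finally have "ennreal (1/16) * 1 \<le> ennreal (1/16) * (16 * (\<Sum>\<^sub>\<infinity>i\<in>I. ennreal (diameter (U i) powr t)))"
      by (intro mult_left_mono) (simp_all add: emeasure_lborel_Times)
    also have "\<dots> = (ennreal (1/16) * ennreal 16) * (\<Sum>\<^sub>\<infinity>i\<in>I. ennreal (diameter (U i) powr t))"
      by (simp add: mult.assoc)
    also have "ennreal (1/16) * ennreal 16 = 1"
      by (subst ennreal_mult[symmetric]) auto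
    finally show "ennreal (1/16) \<le> (\<Sum>\<^sub>\<infinity>i\<in>I. ennreal (diameter (U i) powr t))" by simp
  qed
  also have "\<dots> \<le> hausdorff_measure t cantor_square" by (rule premeasure_le_measure) simp
  finally show ?thesis by (auto simp: ennreal_zero_less_divide)
qed

section \<open>Dimension and measure of the square of the Cantor set\<close>

lemma hausdorff_dim_cantor_square: "hausdorff_dim cantor_square = log 3 4"
proof -
  have eq: "{t. 0 \<le> t \<and> hausdorff_measure t cantor_square = 0} = {log 3 4<..}"
  proof (intro equalityI subsetI)
    fix t assume "t \<in> {t. 0 \<le> t \<and> hausdorff_measure t cantor_square = 0}"
    then show "t \<in> {log 3 4<..}"
      using hausdorff_measure_cantor_square_pos[of t] by (cases "t \<le> log 3 4") auto
  next
    fix t :: real assume "t \<in> {log 3 4<..}"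
    then show "t \<in> {t. 0 \<le> t \<and> hausdorff_measure t cantor_square = 0}"
      using hausdorff_measure_cantor_square_eq_0[of t] order_trans[of 0 "log 3 4" t] by simp
  qed
  show ?thesis unfolding hausdorff_dim_def eq by (rule cInf_greaterThan)
qed

theorem theorem3:
  fixes s :: real
  assumes "s = hausdorff_dim (cantor_set \<times> cantor_set)"
  shows "s = log 3 4 \<and> hausdorff_measure s (cantor_set \<times> cantor_set) \<le> ennreal 1.503263"
  using assms hausdorff_dim_cantor_square hausdorff_measure_cantor_square_le
  unfolding cantor_square_def by simp

end
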